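(* Let $a,b,c$ and $M$ be integers with $M \geq 1$ satisfying $1<a<b<c$ and $1+c=a+b$. If $a \nmid b$, then for every integer $L \geq 0$, $$\frac{1}{(q,q^c;q^M)_L} - \frac{1}{(q^a,q^b;q^M)_L} \succeq 0.$$
   Context: Notation: $(x;q)_n := \prod_{j=0}^{n-1}(1-xq^j)$ and $(x_1,\dots,x_r;q)_n := (x_1;q)_n\cdots(x_r;q)_n$, with empty products equal to $1$; thus $(q^s,q^t;q^M)_L=\prod_{j=0}^{L-1}(1-q^{Mj+s})(1-q^{Mj+t})$. Quotients are expanded as formal power series in $q$. For a power series $f(q)=\sum_{n\ge 0}a_nq^n$, $f(q)\succeq 0$ means $a_n \geq 0$ for all $n$. It is not assumed that $a,b,c \leq M$. *)

theory Defs
  imports "HOL-Computational_Algebra.Formal_Power_Series"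
begin

definition qpoch :: "'a::comm_ring_1 \<Rightarrow> 'a \<Rightarrow> nat \<Rightarrow> 'a" where
  "qpoch x q n = (\<Prod>j<n. 1 - x * q ^ j)"

definition qpochs :: "'a::comm_ring_1 list \<Rightarrow> 'a \<Rightarrow> nat \<Rightarrow> 'a" where
  "qpochs xs q n = (\<Prod>x\<leftarrow>xs. qpoch x q n)"

definition fps_nonneg :: "'a::{linordered_semidom} fps \<Rightarrow> bool"  (\<open>(_) \<succeq> 0\<close> [51] 50) where
  "f \<succeq> 0 \<longleftrightarrow> (\<forall>n. fps_nth f n \<ge> 0)"

text \<open>
  The indeterminate \<open>q\<close> is \<^const>\<open>fps_X\<close>. Quotients of series are taken over the field of
  rationals, where \<^term>\<open>1 / f\<close> is the genuine reciprocal whenever \<open>f\<close> has nonzero constant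
  coefficient; all denominators built from positive powers of \<open>q\<close> have constant coefficient 1.
\<close>
abbreviation q :: "rat fps" where
  "q \<equiv> fps_X"

end

theory Submission
  imports Defs
begin

unbundle fps_syntax

text \<open>
  By the \<open>q\<close>-binomial theorem \<open>1 / (q^s; Q)_L\<close> is the sum of \<open>q^(s n) h n\<close> over all \<open>n\<close>, where
  \<open>h n\<close> is the complete homogeneous symmetric polynomial in \<open>1, Q, \<dots>, Q^(L-1)\<close>. For \<open>L \<ge> 1\<close> the
  sequence \<open>h\<close> is increasing coefficientwise, because \<open>1\<close> is one of the variables. It therefore
  suffices to find an injection \<open>(i, j) \<mapsto> (i', j')\<close> with \<open>i' + c j' = a i + b j\<close> and
  \<open>h i' h j' \<succeq> h i h j\<close>. Trading \<open>min i j\<close> pairs \<open>a + b\<close> for as many pairs \<open>1 + c\<close> and splitting the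
  surplus into ones almost works; the collisions occur at \<open>i < j\<close> with \<open>a\<close> dividing \<open>b (j - i)\<close>, and
  there \<open>c\<close> of the ones are merged into a further \<open>c\<close>. As \<open>a\<close> does not divide \<open>b\<close>, a collision has
  \<open>j - i \<ge> 2\<close>, which leaves enough ones.
\<close>

section \<open>Coefficientwise nonnegativity of power series\<close>

lemma fps_nonneg_add: "f \<succeq> 0 \<Longrightarrow> g \<succeq> 0 \<Longrightarrow> (f + g) \<succeq> 0"
  by (simp add: fps_nonneg_def)

lemma fps_nonneg_mult: "f \<succeq> 0 \<Longrightarrow> g \<succeq> 0 \<Longrightarrow> (f * g) \<succeq> 0"
  by (auto simp: fps_nonneg_def fps_mult_nth intro!: sum_nonneg)

lemma fps_nonneg_one: "1 \<succeq> 0"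
  by (simp add: fps_nonneg_def fps_one_def)

lemma fps_nonneg_zero: "0 \<succeq> 0"
  by (simp add: fps_nonneg_def)

lemma fps_nonneg_power: "f \<succeq> 0 \<Longrightarrow> (f ^ n) \<succeq> 0"
  by (induction n) (auto intro: fps_nonneg_mult fps_nonneg_one)

lemma fps_nonneg_X: "fps_X \<succeq> 0"
  by (simp add: fps_nonneg_def fps_X_def)

lemma fps_nonneg_diff_trans:
  fixes f g h :: "'a::linordered_idom fps"
  shows "(f - g) \<succeq> 0 \<Longrightarrow> (g - h) \<succeq> 0 \<Longrightarrow> (f - h) \<succeq> 0"
  by (auto simp: fps_nonneg_def intro: order_trans)

lemma fps_nonneg_mult_diff:
  fixes f f' g g' :: "'a::linordered_idom fps"
  assumes "(f' - f) \<succeq> 0" "(g' - g) \<succeq> 0" "f \<succeq> 0" "g' \<succeq> 0"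
  shows "(f' * g' - f * g) \<succeq> 0"
proof -
  have "f' * g' - f * g = (f' - f) * g' + f * (g' - g)"
    by (simp add: algebra_simps)
  then show ?thesis
    using assms by (simp add: fps_nonneg_add fps_nonneg_mult)
qed

section \<open>Complete homogeneous polynomials and their monotonicity in the degree\<close>

text \<open>The complete homogeneous symmetric polynomial of degree \<open>n\<close> in \<open>1, Q, \<dots>, Q^(L-1)\<close>, that is, the
  Gaussian binomial coefficient \<open>[L - 1 + n choose n]\<close>.\<close>

fun complete_hom :: "'a::comm_ring_1 \<Rightarrow> nat \<Rightarrow> nat \<Rightarrow> 'a" where
  "complete_hom Q L 0 = 1"
| "complete_hom Q 0 (Suc n) = 0"
| "complete_hom Q (Suc L) (Suc n) = complete_hom Q L (Suc n) + Q ^ L * complete_hom Q (Suc L) n"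

lemma complete_hom_nonneg:
  fixes Q :: "'a::linordered_idom fps"
  assumes "Q \<succeq> 0"
  shows "complete_hom Q L n \<succeq> 0"
  using assms
  by (induction Q L n rule: complete_hom.induct)
    (auto intro: fps_nonneg_add fps_nonneg_mult fps_nonneg_power fps_nonneg_one fps_nonneg_zero)

lemma complete_hom_one: "complete_hom Q (Suc 0) n = 1"
  by (induction n) auto

text \<open>The differences inherit the recurrence of \<open>complete_hom\<close>, so induction on
  \<open>L\<close> and then on \<open>n\<close> applies. At least one variable is required: with
  none the sequence is 1, 0, 0, ...\<close>

lemma complete_hom_Suc_diff_nonneg:
  fixes Q :: "'a::linordered_idom fps"
  assumes "Q \<succeq> 0"
  shows "(complete_hom Q (Suc L) (Suc n) - complete_hom Q (Suc L) n) \<succeq> 0"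
proof (induction L arbitrary: n)
  case 0
  show ?case by (simp only: complete_hom_one diff_self fps_nonneg_zero)
next
  case (Suc L)
  note IH = this
  show ?case
  proof (induction n)
    case 0
    have "complete_hom Q (Suc (Suc L)) (Suc 0) - complete_hom Q (Suc (Suc L)) 0
        = (complete_hom Q (Suc L) (Suc 0) - complete_hom Q (Suc L) 0) + Q ^ Suc L"
      by simp
    then show ?case
      using IH[of 0] assms by (metis fps_nonneg_add fps_nonneg_power)
  next
    case (Suc n)
    have "complete_hom Q (Suc (Suc L)) (Suc (Suc n)) - complete_hom Q (Suc (Suc L)) (Suc n)
        = (complete_hom Q (Suc L) (Suc (Suc n)) - complete_hom Q (Suc L) (Suc n))
        + Q ^ Suc L * (complete_hom Q (Suc (Suc L)) (Suc n) - complete_hom Q (Suc (Suc L)) n)"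
      by (simp only: complete_hom.simps(3)[of Q "Suc L"]) (simp add: algebra_simps)
    then show ?case
      using IH[of "Suc n"] Suc assms by (metis fps_nonneg_add fps_nonneg_mult fps_nonneg_power)
  qed
qed

lemma complete_hom_diff_nonneg:
  fixes Q :: "'a::linordered_idom fps"
  assumes "Q \<succeq> 0" "m \<le> n"
  shows "(complete_hom Q (Suc L) n - complete_hom Q (Suc L) m) \<succeq> 0"
  using assms(2)
proof (induction n rule: dec_induct)
  case base
  show ?case by (simp add: fps_nonneg_zero)
next
  case (step n)
  show ?case
    by (rule fps_nonneg_diff_trans[OF complete_hom_Suc_diff_nonneg[OF assms(1)] step.IH])
qed

section \<open>Reciprocals of q-Pochhammer products as generating functions\<close>

lemma complete_hom_telescope:
  fixes x Q :: "'a::comm_ring_1"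
  shows "(1 - x * Q ^ L) * (\<Sum>n\<le>N. x ^ n * complete_hom Q (Suc L) n)
    = (\<Sum>n\<le>N. x ^ n * complete_hom Q L n) - x ^ Suc N * (Q ^ L * complete_hom Q (Suc L) N)"
proof (induction N)
  case 0
  show ?case by (simp add: algebra_simps)
next
  case (Suc N)
  then show ?case
    by (simp only: sum.atMost_Suc distrib_left complete_hom.simps(3)) (simp add: algebra_simps)
qed

text \<open>Each factor \<open>1 - x * Q ^ L\<close> removes one variable from the generating
  function, up to a boundary term. Truncating at \<open>N\<close> makes this a finite identity in
  any commutative ring, with no convergence involved.\<close>

lemma qpoch_mult_sum_complete_hom:
  fixes x Q :: "'a::comm_ring_1"
  shows "\<exists>r. qpoch x Q L * (\<Sum>n\<le>N. x ^ n * complete_hom Q L n) = 1 + x ^ Suc N * r"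
proof (induction L)
  case 0
  have "(\<Sum>n\<le>N. x ^ n * complete_hom Q 0 n) = 1"
    by (induction N) auto
  then have "qpoch x Q 0 * (\<Sum>n\<le>N. x ^ n * complete_hom Q 0 n) = 1 + x ^ Suc N * 0"
    by (simp add: qpoch_def)
  then show ?case by blast
next
  case (Suc L)
  let ?T = "\<lambda>L. \<Sum>n\<le>N. x ^ n * complete_hom Q L n"
  obtain r where r: "qpoch x Q L * ?T L = 1 + x ^ Suc N * r"
    using Suc.IH by blast
  have "qpoch x Q (Suc L) * ?T (Suc L) = qpoch x Q L * ((1 - x * Q ^ L) * ?T (Suc L))"
    by (simp add: qpoch_def mult.assoc)
  also have "\<dots> = qpoch x Q L * ?T L
      - x ^ Suc N * (qpoch x Q L * (Q ^ L * complete_hom Q (Suc L) N))"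
    by (simp only: complete_hom_telescope) (simp add: algebra_simps)
  also have "\<dots> = 1 + x ^ Suc N * (r - qpoch x Q L * (Q ^ L * complete_hom Q (Suc L) N))"
    by (simp only: r) (simp add: algebra_simps)
  finally show ?case by blast
qed

text \<open>Multiplying by \<open>inverse f\<close> keeps the error divisible by
  \<open>fps_X ^ Suc N\<close>, hence invisible in coefficient \<open>N\<close>.\<close>

lemma fps_nth_one_divide_cong:
  fixes f g r :: "'a::field fps"
  assumes "f * g = 1 + fps_X ^ Suc N * r"
  shows "(1 / f) $ N = g $ N"
proof -
  have "(f * g) $ 0 = 1"
    by (simp add: assms)
  then have f0: "f $ 0 \<noteq> 0"
    by auto
  have "g = inverse f * (f * g)"
    using f0 by (simp add: inverse_mult_eq_1 flip: mult.assoc)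
  also have "\<dots> = inverse f + fps_X ^ Suc N * (r * inverse f)"
    by (simp only: assms) (simp add: algebra_simps)
  finally have "g $ N = (inverse f + fps_X ^ Suc N * (r * inverse f)) $ N"
    by simp
  also have "\<dots> = inverse f $ N"
    by (simp only: fps_add_nth fps_X_power_mult_nth) simp
  finally show ?thesis
    using f0 by (simp add: fps_divide_unit)
qed

lemma pairs_weight_le_subset:
  fixes s t N :: nat
  assumes "s \<ge> 1" "t \<ge> 1"
  shows "{(i, j). s * i + t * j \<le> N} \<subseteq> {..N} \<times> {..N}"
proof clarify
  fix i j assume le: "s * i + t * j \<le> N"
  have "i \<le> s * i" "j \<le> t * j" using assms by auto
  then have "i \<le> N" "j \<le> N" using le by linarith+
  then show "i \<in> {..N} \<and> j \<in> {..N}" by simp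
qed

lemma fps_nth_one_divide_qpochs:
  fixes Q :: "'a::field fps"
  assumes "s \<ge> 1" "t \<ge> 1"
  shows "(1 / qpochs [fps_X ^ s, fps_X ^ t] Q L) $ N
    = (\<Sum>(i, j) | s * i + t * j \<le> N.
        (fps_X ^ (s * i + t * j) * (complete_hom Q L i * complete_hom Q L j)) $ N)"
proof -
  let ?X = "fps_X :: 'a fps"
  let ?T = "\<lambda>s. \<Sum>n\<le>N. (?X ^ s) ^ n * complete_hom Q L n"
  let ?u = "\<lambda>(i, j). (?X ^ (s * i + t * j) * (complete_hom Q L i * complete_hom Q L j)) $ N"
  have *: "\<exists>r. qpoch (?X ^ s) Q L * ?T s = 1 + ?X ^ Suc N * r" if s: "s \<ge> 1" for s
  proof -
    obtain r where "qpoch (?X ^ s) Q L * ?T s = 1 + (?X ^ s) ^ Suc N * r"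
      using qpoch_mult_sum_complete_hom by blast
    also have "(?X ^ s) ^ Suc N * r = ?X ^ Suc N * ((?X ^ (s - 1)) ^ Suc N * r)"
      using s by (simp only: power_minus_mult[symmetric, of s "?X"] power_mult_distrib mult_ac)
    finally show ?thesis by (rule exI)
  qed
  obtain r r' where r: "qpoch (?X ^ s) Q L * ?T s = 1 + ?X ^ Suc N * r"
    and r': "qpoch (?X ^ t) Q L * ?T t = 1 + ?X ^ Suc N * r'"
    using *[OF assms(1)] *[OF assms(2)] by metis
  have "qpochs [?X ^ s, ?X ^ t] Q L * (?T s * ?T t)
      = (qpoch (?X ^ s) Q L * ?T s) * (qpoch (?X ^ t) Q L * ?T t)"
    by (simp add: qpochs_def)
  also have "\<dots> = 1 + ?X ^ Suc N * (r + r' + ?X ^ Suc N * (r * r'))"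
    by (simp only: r r') (simp add: algebra_simps)
  finally have "(1 / qpochs [?X ^ s, ?X ^ t] Q L) $ N = (?T s * ?T t) $ N"
    by (rule fps_nth_one_divide_cong)
  also have "?T s * ?T t = (\<Sum>i\<le>N. \<Sum>j\<le>N.
      ?X ^ (s * i + t * j) * (complete_hom Q L i * complete_hom Q L j))"
    by (simp add: sum_product power_add mult_ac flip: power_mult)
  also have "\<dots> $ N = (\<Sum>p\<in>{..N} \<times> {..N}. ?u p)"
    by (simp add: fps_sum_nth sum.cartesian_product case_prod_unfold)
  \<comment> \<open>Terms of weight above \<open>N\<close> do not reach coefficient
    \<open>N\<close>. Cutting by weight gives index sets that a weight-preserving map
    respects.\<close>
  also have "\<dots> = (\<Sum>p\<in>{(i, j). s * i + t * j \<le> N}. ?u p)"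
  proof (rule sum.mono_neutral_right)
    show "{(i, j). s * i + t * j \<le> N} \<subseteq> {..N} \<times> {..N}"
      by (rule pairs_weight_le_subset[OF assms])
  qed (auto simp: fps_X_power_mult_nth split: if_splits)
  finally show ?thesis by simp
qed

section \<open>The weight-preserving injection\<close>

text \<open>In the middle case the image \<open>(i + b * (j - i), i)\<close> would already be taken
  by some \<open>(i + d, i)\<close> with \<open>a * d = b * (j - i)\<close>. The subtracted
  \<open>a + b - 1\<close> is \<open>c\<close>.\<close>

definition exchange :: "nat \<Rightarrow> nat \<Rightarrow> nat \<times> nat \<Rightarrow> nat \<times> nat" where
  "exchange a b = (\<lambda>(i, j).
     if j \<le> i then (j + a * (i - j), j)
     else if a dvd b * (j - i) then (i + b * (j - i) - (a + b - 1), Suc i)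
     else (i + b * (j - i), i))"

locale exchange_params =
  fixes a b c :: nat
  assumes ab: "1 < a" "a < b" and c: "1 + c = a + b" and ndvd: "\<not> a dvd b"
begin

text \<open>For \<open>j - i = 2 + e\<close> the surplus \<open>b * (j - i)\<close> is at least
  \<open>2 * b + e\<close>, while \<open>c + (j - i) = a + b + 1 + e\<close>. Besides making the
  truncated subtraction exact, this leaves at least \<open>j\<close> ones, as
  \<open>exchange_mono\<close> needs.\<close>

lemma collision_bound:
  assumes "i < j" "a dvd b * (j - i)"
  shows "c + j \<le> i + b * (j - i)"
proof -
  define d where "d = j - i"
  have "d \<noteq> 1" "d \<noteq> 0" using assms ndvd by (auto simp: d_def)
  then have "2 \<le> d" by linarith
  then obtain e where e: "d = 2 + e" using le_Suc_ex by blast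
  have "e \<le> b * e" using ab by simp
  moreover have "b * d = b + b + b * e" by (simp add: e algebra_simps)
  ultimately have "c + d \<le> b * d" using ab c e by linarith
  moreover have "j = i + d" using assms by (simp add: d_def)
  ultimately show ?thesis by simp
qed

lemma exchange_cases:
  obtains
    (ge) j d where "p = (j + d, j)" "exchange a b p = (j + a * d, j)"
  | (collision) i d y where "p = (i, i + d)" "a dvd b * d" "b * d = y + c" "d \<le> y"
      "exchange a b p = (i + y, Suc i)"
  | (less) i d where "p = (i, i + d)" "\<not> a dvd b * d" "exchange a b p = (i + b * d, i)"
proof -
  obtain i j where p: "p = (i, j)" by fastforce
  show ?thesis
  proof (cases "j \<le> i")
    case True
    then show ?thesis using ge[of j "i - j"] p by (simp add: exchange_def)
  next
    case False
    show ?thesis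
    proof (cases "a dvd b * (j - i)")
      case True
      have "c + j \<le> i + b * (j - i)"
        using collision_bound True False by simp
      moreover have "a + b - 1 = c" using c by simp
      ultimately show ?thesis
        using collision[of i "j - i" "b * (j - i) - c"] p True False
        by (simp add: exchange_def)
    next
      case ndvd: False
      then show ?thesis using less[of i "j - i"] p False by (simp add: exchange_def)
    qed
  qed
qed

lemma exchange_weight:
  assumes "exchange a b (i, j) = (i', j')"
  shows "i' + c * j' = a * i + b * j"
proof -
  have c': "k + c * k = a * k + b * k" for k
    using c by (metis add_mult_distrib mult_1)
  show ?thesis
    by (cases "(i, j)" rule: exchange_cases) (use assms in \<open>auto simp: algebra_simps intro: c'\<close>)
qed

lemma inj_exchange: "inj (exchange a b)"
proof (rule injI)
  \<comment> \<open>Equal second components force \<open>j = Suc i\<close>, so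
    \<open>y = Suc (a * d)\<close>; the same shift produces the \<open>Suc\<close> in
    \<open>less_collision\<close>.\<close>
  have ge_collision: False if "b * d' = Suc (a * d) + c" "a dvd b * d'" for d d'
  proof -
    have "b * d' = a * Suc d + b" using that c by simp
    then show False using that(2) ndvd by (metis dvd_add_right_iff dvd_triv_left)
  qed
  have less_collision: False if "b * d = Suc (b * d') + c" for d d'
  proof -
    have "b * d = b * Suc d' + a" using that c by simp
    then have "b dvd a" by (metis dvd_add_right_iff dvd_triv_left)
    then show False using ab by (auto dest: dvd_imp_le)
  qed
  have ge_less: False if "a * d = b * d'" "\<not> a dvd b * d'" for d d'
    using that by (metis dvd_triv_left)
  have collision_collision: "d = d'" if "b * d = n" "b * d' = n" for d d' n
    using that ab by auto
  fix p p' assume eq: "exchange a b p = exchange a b p'"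
  show "p = p'"
    by (cases p rule: exchange_cases; cases p' rule: exchange_cases)
      (use eq ab ge_collision less_collision in
        \<open>auto dest: ge_less intro: collision_collision\<close>)
qed

text \<open>The new pair dominates the old one componentwise, after swapping the old entries when
  \<open>i < j\<close>.\<close>

lemma exchange_mono:
  fixes h :: "nat \<Rightarrow> 'a::linordered_idom fps"
  assumes "\<And>n. h n \<succeq> 0" "\<And>m n. m \<le> n \<Longrightarrow> (h n - h m) \<succeq> 0"
    and "exchange a b (i, j) = (i', j')"
  shows "(h i' * h j' - h i * h j) \<succeq> 0"
proof -
  have 1: "(h i' * h j' - h i * h j) \<succeq> 0" if "i \<le> i'" "j \<le> j'" for i j
    by (rule fps_nonneg_mult_diff) (use that assms in auto)
  have 2: "(h i' * h j' - h i * h j) \<succeq> 0" if "j \<le> i'" "i \<le> j'" for i j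
    using 1[OF that] by (simp add: mult.commute)
  have "i \<le> i' \<and> j \<le> j' \<or> j \<le> i' \<and> i \<le> j'"
    by (cases "(i, j)" rule: exchange_cases) (use assms(3) ab in auto)
  then show ?thesis using 1 2 by blast
qed

end

theorem theorem1p1:
  fixes a b c M :: nat
  assumes "M \<ge> 1"
    and "1 < a" and "a < b" and "b < c"
    and "1 + c = a + b"
    and "\<not> a dvd b"
  shows "\<forall>L::nat. (1 / qpochs [q, q ^ c] (q ^ M) L - 1 / qpochs [q ^ a, q ^ b] (q ^ M) L) \<succeq> 0"
proof
  interpret exchange_params a b c
    using assms by unfold_locales auto
  fix L
  show "(1 / qpochs [q, q ^ c] (q ^ M) L - 1 / qpochs [q ^ a, q ^ b] (q ^ M) L) \<succeq> 0"
  proof (cases L)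
    \<comment> \<open>Both products are empty here; \<open>h\<close> is monotone only for positive
      \<open>L\<close>.\<close>
    case 0
    then show ?thesis by (simp add: qpochs_def qpoch_def fps_nonneg_zero)
  next
    case (Suc L')
    define h where "h = complete_hom (q ^ M) L"
    have qM: "(q ^ M) \<succeq> 0" by (intro fps_nonneg_power fps_nonneg_X)
    have h_nonneg: "h n \<succeq> 0" for n
      by (simp add: h_def complete_hom_nonneg qM)
    have h_mono: "(h n - h m) \<succeq> 0" if "m \<le> n" for m n
      using complete_hom_diff_nonneg[OF qM that] by (simp add: h_def Suc)
    have "(1 / qpochs [q ^ a, q ^ b] (q ^ M) L) $ N \<le> (1 / qpochs [q, q ^ c] (q ^ M) L) $ N" for N
    proof -
      define u where "u s t = (\<lambda>(i, j). (q ^ (s * i + t * j) * (h i * h j)) $ N)" for s t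
      have u_nonneg: "0 \<le> u s t p" for s t p
      proof -
        have "(q ^ (s * i + t * j) * (h i * h j)) \<succeq> 0" for i j
          by (intro fps_nonneg_mult fps_nonneg_power fps_nonneg_X h_nonneg)
        then show ?thesis by (simp add: u_def fps_nonneg_def split: prod.split)
      qed
      let ?A = "{(i, j). a * i + b * j \<le> N}"
      let ?C = "{(i, j). 1 * i + c * j \<le> N}"
      have fin: "finite ?C"
        by (rule finite_subset[OF pairs_weight_le_subset]) (use assms in auto)
      have "(1 / qpochs [q ^ a, q ^ b] (q ^ M) L) $ N = sum (u a b) ?A"
        using assms by (subst fps_nth_one_divide_qpochs) (auto simp: u_def h_def)
      also have "\<dots> \<le> (\<Sum>p\<in>?A. u 1 c (exchange a b p))"
      proof (rule sum_mono)
        fix p :: "nat \<times> nat"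
        obtain i j i' j' where p: "p = (i, j)" and e: "exchange a b (i, j) = (i', j')"
          by (metis surj_pair)
        \<comment> \<open>Both terms carry the same power of \<open>q\<close>, since
          \<open>exchange\<close> preserves weight.\<close>
        have "(q ^ (a * i + b * j) * (h i' * h j' - h i * h j)) \<succeq> 0"
          by (intro fps_nonneg_mult fps_nonneg_power fps_nonneg_X
              exchange_mono[OF h_nonneg h_mono e])
        then show "u a b p \<le> u 1 c (exchange a b p)"
          using exchange_weight[OF e]
          by (simp add: u_def p e fps_nonneg_def right_diff_distrib)
      qed
      also have "\<dots> = sum (u 1 c) (exchange a b ` ?A)"
        using inj_exchange by (subst sum.reindex) (auto intro: inj_on_subset)
      also have "\<dots> \<le> sum (u 1 c) ?C"
      proof (rule sum_mono2[OF fin])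
        show "exchange a b ` ?A \<subseteq> ?C"
        proof clarify
          fix i j i' j' assume "a * i + b * j \<le> N" "(i', j') = exchange a b (i, j)"
          then show "1 * i' + c * j' \<le> N"
            using exchange_weight[of i j i' j'] by simp
        qed
      qed (rule u_nonneg)
      also have "\<dots> = (1 / qpochs [q ^ 1, q ^ c] (q ^ M) L) $ N"
        using assms by (subst fps_nth_one_divide_qpochs) (auto simp: u_def h_def)
      finally show ?thesis by simp
    qed
    then show ?thesis by (simp add: fps_nonneg_def)
  qed
qed

end
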